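(* Let $\alpha\in(0,1)$ and $q>\alpha$. Let $Z\sim\kappa_q(1,\cdot)$ be a random continuous nonnegative path on $[0,1]$ with $Z(0)=Z(1)=0$. Suppose that $Z$ is $\gamma$-Hölder continuous for some $\gamma\in(0,q)$, that $D_\gamma:=\sup_{0\le r<s\le 1}\frac{|Z(s)-Z(r)|}{|s-r|^\gamma}$ has moments of all orders, and that $c:=(1+\alpha)(\Gamma(1-\alpha))^{-1}\mathbb{E}((Z(U))^{\alpha/q})>0$, where $U$ is uniform on $[0,1]$ and independent of $Z$. Let $X$ be a $\kappa_q$-marked spectrally positive stable Lévy process with Laplace exponent $\psi(\eta)=\eta^{1+\alpha}$ and marks $Z_t$. Then the uniform Hölder constant for all paths $Z_t$ is finite a.s.: for all $T>0$, $$D_{[0,T]}:=\sup_{0\le t\le T}\ \sup_{0\le x<y\le\Delta X_t}\frac{|Z_t(y)-Z_t(x)|}{|y-x|^\gamma}<\infty\quad\text{a.s.}$$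
   Context: $X=(X_t,t\ge 0)$ is a Lévy process with $X_0=0$, no negative jumps, and $\mathbb{E}(e^{-\eta X_t})=e^{t\psi(\eta)}$, $\eta\ge 0$. Write $\Delta X_t=X_t-X_{t-}$. $\kappa_q$-marking: for $x>0$, $\kappa_q(x,\cdot)$ is the distribution of $(x^qZ(s/x),0\le s\le x)$, where $Z\sim\kappa_q(1,\cdot)$. Given $X$, each jump $(t,\Delta X_t)$ with $\Delta X_t>0$ is marked, independently over the jumps, by a random path $Z_t=(Z_t(s),0\le s\le\Delta X_t)$ with distribution $\kappa_q(\Delta X_t,\cdot)$. In the supremum, times $t$ with $\Delta X_t=0$ contribute $0$. A random variable $V$ has moments of all orders if $\mathbb{E}(|V|^p)<\infty$ for all $p>0$. *)

theory Defs
  imports "HOL-Probability.Probability"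
begin

definition cadlag :: "(real \<Rightarrow> real) \<Rightarrow> bool" where
  "cadlag f \<longleftrightarrow>
     (\<forall>t\<ge>0. (f \<longlongrightarrow> f t) (at_right t)) \<and> (\<forall>t>0. \<exists>l. (f \<longlongrightarrow> l) (at_left t))"

text \<open>There is no jump at time 0, i.e. the left limit at 0 is read as the value at 0.\<close>

definition jump :: "(real \<Rightarrow> real) \<Rightarrow> real \<Rightarrow> real" where
  "jump f t = (if t > 0 then f t - Lim (at_left t) f else 0)"

text \<open>The time index is a real number; only the values at times \<open>t \<ge> 0\<close> are relevant.\<close>

definition levy_process :: "'a measure \<Rightarrow> (real \<Rightarrow> 'a \<Rightarrow> real) \<Rightarrow> bool" where
  "levy_process M X \<longleftrightarrow>
     prob_space M \<and>
     (\<forall>t\<ge>0. X t \<in> borel_measurable M) \<and>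
     (\<forall>\<omega>\<in>space M. X 0 \<omega> = 0) \<and>
     (\<forall>\<omega>\<in>space M. cadlag (\<lambda>t. X t \<omega>)) \<and>
     (\<forall>(n::nat) (t :: nat \<Rightarrow> real). 0 \<le> t 0 \<longrightarrow> (\<forall>i<n. t i \<le> t (Suc i)) \<longrightarrow>
        prob_space.indep_vars M (\<lambda>_. borel) (\<lambda>i \<omega>. X (t (Suc i)) \<omega> - X (t i) \<omega>) {..<n}) \<and>
     (\<forall>s\<ge>0. \<forall>h\<ge>0. distr M borel (\<lambda>\<omega>. X (s + h) \<omega> - X s \<omega>) = distr M borel (X h))"

definition no_negative_jumps :: "'a measure \<Rightarrow> (real \<Rightarrow> 'a \<Rightarrow> real) \<Rightarrow> bool" where
  "no_negative_jumps M X \<longleftrightarrow> (\<forall>\<omega>\<in>space M. \<forall>t\<ge>0. 0 \<le> jump (\<lambda>t. X t \<omega>) t)"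

definition has_laplace_exponent ::
    "'a measure \<Rightarrow> (real \<Rightarrow> 'a \<Rightarrow> real) \<Rightarrow> (real \<Rightarrow> real) \<Rightarrow> bool" where
  "has_laplace_exponent M X \<psi> \<longleftrightarrow>
     (\<forall>t\<ge>0. \<forall>\<eta>\<ge>0. has_bochner_integral M (\<lambda>\<omega>. exp (- \<eta> * X t \<omega>)) (exp (t * \<psi> \<eta>)))"

text \<open>
  A continuous path on \<open>[0, x]\<close> vanishing at both endpoints is identified with its extension
  by 0 to the whole line, which is again continuous. This puts the paths of all lengths
  into one space, the continuous functions on the line, with the sigma-algebra generated by
  the evaluation maps.
\<close>

definition path_space :: "(real \<Rightarrow> real) measure" where
  "path_space = restrict_space (Pi\<^sub>M UNIV (\<lambda>_. borel)) {f. continuous_on UNIV f}"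

definition nonneg_bridge :: "real \<Rightarrow> (real \<Rightarrow> real) \<Rightarrow> bool" where
  "nonneg_bridge x f \<longleftrightarrow>
     continuous_on UNIV f \<and> f 0 = 0 \<and> f x = 0 \<and> (\<forall>s\<in>{0..x}. 0 \<le> f s) \<and> (\<forall>s. s \<notin> {0..x} \<longrightarrow> f s = 0)"

text \<open>
  The distribution of \<open>(x\<^sup>q Z(s/x), 0 \<le> s \<le> x)\<close> for \<open>x > 0\<close> and a random path \<open>Z\<close> on \<open>[0, 1]\<close>;
  the scaling carries the extension of \<open>Z\<close> by 0 off \<open>[0, 1]\<close> to the one off \<open>[0, x]\<close>.
\<close>

definition scaled_law ::
    "'b measure \<Rightarrow> ('b \<Rightarrow> real \<Rightarrow> real) \<Rightarrow> real \<Rightarrow> real \<Rightarrow> (real \<Rightarrow> real) measure" where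
  "scaled_law N Z q x = distr N path_space (\<lambda>\<omega> s. x powr q * Z \<omega> (s / x))"

definition process_algebra :: "'a measure \<Rightarrow> (real \<Rightarrow> 'a \<Rightarrow> real) \<Rightarrow> 'a measure" where
  "process_algebra M X =
     vimage_algebra (space M) (\<lambda>\<omega>. \<lambda>t\<in>{0..}. X t \<omega>) (Pi\<^sub>M {0..} (\<lambda>_. borel))"

text \<open>
  Given \<open>X\<close>, the marks \<open>Z\<^sub>t\<close> of the jumps are independent, with distributions \<open>\<kappa> (\<Delta>X\<^sub>t)\<close>.
  The jump times are random, so this is expressed through the jump times
  \<open>T\<^sub>0, \<dots>, T\<^sub>n\<^sub>-\<^sub>1\<close> that are selected, and pairwise distinct, as measurable functions of \<open>X\<close>:
  on each event \<open>A\<close> of the sigma-algebra of \<open>X\<close> on which they are such times, the conditional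
  law of their marks is the product of the \<open>\<kappa> (\<Delta>X\<^bsub>T i\<^esub>)\<close>.
\<close>

definition marked_process ::
    "'a measure \<Rightarrow> (real \<Rightarrow> 'a \<Rightarrow> real) \<Rightarrow> (real \<Rightarrow> (real \<Rightarrow> real) measure) \<Rightarrow>
     (real \<Rightarrow> 'a \<Rightarrow> real \<Rightarrow> real) \<Rightarrow> bool" where
  "marked_process M X \<kappa> Zm \<longleftrightarrow>
     (\<forall>(n::nat) (T :: nat \<Rightarrow> 'a \<Rightarrow> real) A (B :: nat \<Rightarrow> (real \<Rightarrow> real) set).
        A \<in> sets (process_algebra M X) \<longrightarrow>
        (\<forall>i<n. T i \<in> borel_measurable (process_algebra M X)) \<longrightarrow>
        (\<forall>\<omega>\<in>A. inj_on (\<lambda>i. T i \<omega>) {..<n} \<and>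
           (\<forall>i<n. 0 \<le> T i \<omega> \<and> 0 < jump (\<lambda>t. X t \<omega>) (T i \<omega>))) \<longrightarrow>
        (\<forall>i<n. B i \<in> sets path_space) \<longrightarrow>
        {\<omega>\<in>A. \<forall>i<n. Zm (T i \<omega>) \<omega> \<in> B i} \<in> sets M \<and>
        emeasure M {\<omega>\<in>A. \<forall>i<n. Zm (T i \<omega>) \<omega> \<in> B i} =
          (\<integral>\<^sup>+\<omega>\<in>A. (\<Prod>i<n. emeasure (\<kappa> (jump (\<lambda>t. X t \<omega>) (T i \<omega>))) (B i)) \<partial>M))"

definition hoelder_on :: "real \<Rightarrow> real set \<Rightarrow> (real \<Rightarrow> real) \<Rightarrow> bool" where
  "hoelder_on \<gamma> S f \<longleftrightarrow> (\<exists>C. \<forall>r\<in>S. \<forall>s\<in>S. \<bar>f s - f r\<bar> \<le> C * \<bar>s - r\<bar> powr \<gamma>)"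

definition hoelder_const :: "real \<Rightarrow> real \<Rightarrow> (real \<Rightarrow> real) \<Rightarrow> ennreal" where
  "hoelder_const \<gamma> x f =
     (SUP (r, s) \<in> {(r, s). 0 \<le> r \<and> r < s \<and> s \<le> x}. ennreal (\<bar>f s - f r\<bar> / \<bar>s - r\<bar> powr \<gamma>))"

definition moments_of_all_orders :: "'b measure \<Rightarrow> ('b \<Rightarrow> real) \<Rightarrow> bool" where
  "moments_of_all_orders N V \<longleftrightarrow> (\<forall>p>0. integrable N (\<lambda>\<omega>. \<bar>V \<omega>\<bar> powr p))"

text \<open>
  At times without a jump the inner supremum is over the empty set, hence 0 in \<^typ>\<open>ennreal\<close>.
\<close>

definition uniform_hoelder_const ::
    "(real \<Rightarrow> 'a \<Rightarrow> real) \<Rightarrow> (real \<Rightarrow> 'a \<Rightarrow> real \<Rightarrow> real) \<Rightarrow> real \<Rightarrow> real \<Rightarrow> 'a \<Rightarrow> ennreal" where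
  "uniform_hoelder_const X Zm \<gamma> T \<omega> =
     (SUP t\<in>{0..T}. hoelder_const \<gamma> (jump (\<lambda>t. X t \<omega>) t) (Zm t \<omega>))"

end

theory Submission
  imports Defs
begin

text \<open>
  A path with law \<open>\<kappa>\<^sub>q(x, \<cdot>)\<close> is \<open>x\<^sup>q Z(s/x)\<close>, so its Hoelder constant is \<open>x\<^bsup>q-\<gamma>\<^esup> D\<close> with \<open>D\<close>
  distributed as \<open>D\<^sub>\<gamma>\<close>. By Markov's inequality it exceeds \<open>K\<close> with probability at most
  \<open>\<bbbE>(D\<^sup>p) K\<^bsup>-p\<^esup> x\<^bsup>p(q-\<gamma>)\<^esup>\<close>, and the choice \<open>p = 2/(q-\<gamma>)\<close> makes this a multiple of \<open>x\<^sup>2\<close>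
  (\<open>scaled_law_hoelder_paths\<close>). Since jumps of a Levy process are square summable up to a bounded
  size, the expected number of jumps in \<open>[0, T]\<close> of size at most \<open>L\<close> whose mark has Hoelder
  constant above \<open>K\<close> is \<open>O(K\<^bsup>-p\<^esup>)\<close>. Let \<open>K\<close> tend to infinity: almost surely some \<open>K\<close> serves for all
  marks of jumps of size at most \<open>L\<close>. A cadlag path has bounded jumps on \<open>[0, T]\<close>, so letting \<open>L\<close>
  range over the natural numbers finishes the argument.

  Square summability is used in the following form. For \<open>w(x) = (1 - e\<^bsup>-x\<^esup>)\<^sup>2\<close>, which is comparable
  to \<open>x\<^sup>2\<close> on \<open>[0, L]\<close>, the Laplace exponent gives
  \<open>\<bbbE> w(X\<^bsub>s+h\<^esub> - X\<^sub>s) = e\<^bsup>h\<psi>(2)\<^esup> - 2e\<^bsup>h\<psi>(1)\<^esup> + 1 = O(h)\<close>; here \<open>X\<close> need not have a second moment.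
  A jump in \<open>(a, b]\<close> is a limit of increments of \<open>X\<close> over the cells of finer and finer partitions,
  so Fatou's lemma bounds the expected weight of any one jump selected from \<open>(a, b]\<close> by a multiple
  of \<open>b - a\<close> (\<open>nn_integral_jump_weight_le\<close>).

  The marks are accessible only at jump times that are measurable functions of \<open>X\<close>. Rather than
  enumerating all jumps, the argument cuts \<open>(0, T]\<close> into \<open>n + 1\<close> equal cells and selects in each cell
  the first jump larger than \<open>1/(m + 1)\<close>. These jumps are finitely many, so for large \<open>n\<close> no cell
  contains two of them and each is selected. The probability that some selected jump is bad is
  bounded uniformly in \<open>m\<close> and \<open>n\<close>, and the bound passes to the limits in \<open>n\<close> and then in \<open>m\<close>
  (\<open>AE_marks_of_small_jumps_in_some\<close>).
\<close>

section \<open>Jumps of cadlag functions\<close>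

lemma cadlag_tendsto_left:
  assumes "cadlag f" "0 < u"
  shows "(f \<longlongrightarrow> f u - jump f u) (at_left u)"
proof -
  obtain l where l: "(f \<longlongrightarrow> l) (at_left u)"
    using assms unfolding cadlag_def by blast
  then have "Lim (at_left u) f = l"
    by (intro tendsto_Lim) auto
  then show ?thesis using l assms(2) by (simp add: jump_def)
qed

lemma jump_LIMSEQ:
  assumes f: "cadlag f" and u: "0 < u"
    and p: "p \<longlonglongrightarrow> u" "\<And>n. p n < u" and r: "r \<longlonglongrightarrow> u" "\<And>n. u \<le> r n"
  shows "(\<lambda>n. f (r n) - f (p n)) \<longlonglongrightarrow> jump f u"
proof -
  have "filterlim p (at_left u) sequentially"
    using p by (intro tendsto_imp_filterlim_at_left) auto
  then have L: "(\<lambda>n. f (p n)) \<longlonglongrightarrow> f u - jump f u"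
    by (rule filterlim_compose[OF cadlag_tendsto_left[OF f u]])
  have "continuous (at_right u) f"
    using f u by (simp add: continuous_within cadlag_def)
  then have "continuous (at u within {u..}) f"
    by (simp add: at_within_Ici_at_right)
  then have R: "(\<lambda>n. f (r n)) \<longlonglongrightarrow> f u"
    by (rule continuous_within_tendsto_compose') (use r in auto)
  show ?thesis using tendsto_diff[OF R L] by simp
qed

text \<open>
  Near \<open>x\<close>, an increment that is not small must straddle \<open>x\<close>, and then it is close to the jump at
  \<open>x\<close>. Both compactness arguments below rest on this.
\<close>

lemma cadlag_oscillation:
  assumes f: "cadlag f" and x: "0 \<le> x" and e: "0 < e"
  obtains \<delta> where "\<delta> > 0"
    "\<And>p r. \<lbrakk>0 \<le> p; p < r; \<bar>p - x\<bar> < \<delta>; \<bar>r - x\<bar> < \<delta>\<rbrakk> \<Longrightarrow>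
       f r - f p < e \<or> (p < x \<and> x \<le> r \<and> f r - f p < jump f x + e)"
proof -
  have "(f \<longlongrightarrow> f x) (at_right x)" using f x by (simp add: cadlag_def)
  then have "\<forall>\<^sub>F y in at_right x. dist (f y) (f x) < e / 2"
    using e by (intro tendstoD) auto
  then obtain b where b: "b > x" "\<And>y. x < y \<Longrightarrow> y < b \<Longrightarrow> dist (f y) (f x) < e / 2"
    unfolding eventually_at_right_field by blast
  then have b': "\<bar>f y - f x\<bar> < e / 2" if "x \<le> y" "y < b" for y
    using that e by (cases "x = y") (auto simp: dist_real_def)
  obtain a where a: "a < x" "\<And>y. a < y \<Longrightarrow> y < x \<Longrightarrow> 0 \<le> y \<Longrightarrow> \<bar>f y - (f x - jump f x)\<bar> < e / 2"
  proof (cases "x = 0")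
    case True
    then show ?thesis using that[of "-1"] by auto
  next
    case False
    then have "(f \<longlongrightarrow> f x - jump f x) (at_left x)"
      using cadlag_tendsto_left[OF f] x by simp
    then have "\<forall>\<^sub>F y in at_left x. dist (f y) (f x - jump f x) < e / 2"
      using e by (intro tendstoD) auto
    then show ?thesis
      using that unfolding eventually_at_left_field dist_real_def by blast
  qed
  show ?thesis
  proof (rule that[of "min (b - x) (x - a)"])
    fix p r assume pr: "0 \<le> p" "p < r" "\<bar>p - x\<bar> < min (b - x) (x - a)" "\<bar>r - x\<bar> < min (b - x) (x - a)"
    consider "x \<le> p" | "r < x" | "p < x" "x \<le> r" using pr by linarith
    then show "f r - f p < e \<or> (p < x \<and> x \<le> r \<and> f r - f p < jump f x + e)"
    proof cases
      case 1
      then have "\<bar>f p - f x\<bar> < e / 2" "\<bar>f r - f x\<bar> < e / 2"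
        using pr by (intro b'; linarith)+
      then show ?thesis by linarith
    next
      case 2
      then have "\<bar>f p - (f x - jump f x)\<bar> < e / 2" "\<bar>f r - (f x - jump f x)\<bar> < e / 2"
        using pr by (intro a(2); linarith)+
      then show ?thesis by linarith
    next
      case 3
      then have "\<bar>f p - (f x - jump f x)\<bar> < e / 2" "\<bar>f r - f x\<bar> < e / 2"
        using pr by (intro a(2) b'; linarith)+
      then show ?thesis using 3 by linarith
    qed
  qed (use a b in auto)
qed

text \<open>
  At an accumulation point of times of jumps larger than \<open>e\<close>, increments larger than \<open>e\<close> would occur
  arbitrarily close to it on one side, against the existence of the one-sided limits.
\<close>

lemma finite_jumps_gt:
  assumes f: "cadlag f" and e: "0 < e"
  shows "finite {u\<in>{0<..b}. e < jump f u}"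
proof (rule ccontr)
  let ?J = "{u\<in>{0<..b}. e < jump f u}"
  assume "infinite ?J"
  moreover have "?J \<subseteq> {0..b}" by auto
  ultimately obtain x where x: "x \<in> {0..b}" "x islimpt ?J"
    using compact_eq_Bolzano_Weierstrass[of "{0..b}"] by auto
  then obtain \<delta> where \<delta>: "\<delta> > 0"
    "\<And>p r. \<lbrakk>0 \<le> p; p < r; \<bar>p - x\<bar> < \<delta>; \<bar>r - x\<bar> < \<delta>\<rbrakk> \<Longrightarrow>
       f r - f p < e \<or> (p < x \<and> x \<le> r \<and> f r - f p < jump f x + e)"
    using cadlag_oscillation[OF f _ e, of x] by auto
  obtain u where u: "u \<in> ?J" "u \<noteq> x" "\<bar>u - x\<bar> < \<delta>"
    using x(2) \<delta>(1) unfolding islimpt_approachable dist_real_def by blast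
  define w where "w = (if x < u then x else max 0 (x - \<delta>))"
  have w: "0 \<le> w" "w < u" using u x(1) by (auto simp: w_def)
  \<comment> \<open>On \<open>{w<..<u}\<close> the interval from \<open>p\<close> to \<open>u\<close> stays on one side of \<open>x\<close>.\<close>
  have "\<forall>\<^sub>F p in at_left u. w < p \<and> p < u"
    using w(2) by (auto simp: eventually_at_left_field)
  then have "\<forall>\<^sub>F p in at_left u. f u - f p \<le> e"
  proof eventually_elim
    case (elim p)
    then have "\<not> (p < x \<and> x \<le> u)" "\<bar>p - x\<bar> < \<delta>" 
      using u(2,3) by (auto simp: w_def split: if_splits)
    then show ?case using \<delta>(2)[of p u] elim w u(3) by auto
  qed
  moreover have "((\<lambda>p. f u - f p) \<longlongrightarrow> f u - (f u - jump f u)) (at_left u)"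
    using u by (intro tendsto_diff tendsto_const cadlag_tendsto_left f) auto
  ultimately have "f u - (f u - jump f u) \<le> e"
    by (intro tendsto_upperbound) auto
  then show False using u by auto
qed

lemma jumps_bounded:
  assumes "cadlag f"
  obtains L :: nat where "\<And>u. u \<in> {0<..b} \<Longrightarrow> jump f u \<le> real L"
proof -
  have "finite (jump f ` {u\<in>{0<..b}. 1 < jump f u})"
    using finite_jumps_gt[OF assms, of 1] by simp
  then have "bdd_above (jump f ` {u\<in>{0<..b}. 1 < jump f u})" by (rule bdd_above_finite)
  then obtain B where "\<forall>y\<in>jump f ` {u\<in>{0<..b}. 1 < jump f u}. y \<le> B"
    unfolding bdd_above_def by blast
  then have B: "\<And>u. u \<in> {0<..b} \<Longrightarrow> 1 < jump f u \<Longrightarrow> jump f u \<le> B" by simp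
  show ?thesis
  proof (rule that[of "nat \<lceil>max 1 B\<rceil>"])
    fix u assume "u \<in> {0<..b}"
    then have "jump f u \<le> max 1 B" using B[of u] by (cases "1 < jump f u") auto
    then show "jump f u \<le> real (nat \<lceil>max 1 B\<rceil>)" by linarith
  qed
qed

section \<open>Jumps as limits of increments over equal partitions\<close>

definition grid :: "real \<Rightarrow> real \<Rightarrow> nat \<Rightarrow> nat \<Rightarrow> real" where
  "grid a b m j = a + real j * ((b - a) / real (Suc m))"

definition grid_cell :: "real \<Rightarrow> real \<Rightarrow> nat \<Rightarrow> nat \<Rightarrow> real set" where
  "grid_cell a b m j = {grid a b m j<..grid a b m (Suc j)}"

lemma grid_Suc: "grid a b m (Suc j) = grid a b m j + (b - a) / real (Suc m)"
  unfolding grid_def of_nat_Suc distrib_right by simp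

lemma grid_ge: "a \<le> b \<Longrightarrow> a \<le> grid a b m j"
  by (simp add: grid_def)

lemma grid_le: 
  assumes "a \<le> b" "j \<le> Suc m" shows "grid a b m j \<le> b"
proof -
  have "real j * ((b - a) / real (Suc m)) \<le> real (Suc m) * ((b - a) / real (Suc m))"
    using assms by (intro mult_right_mono) auto
  then show ?thesis by (simp add: grid_def)
qed

lemma in_grid_cell:
  assumes "a < u" "u \<le> b"
  obtains j where "j \<le> m" "u \<in> grid_cell a b m j"
proof -
  define h where "h = (b - a) / real (Suc m)"
  have h: "h > 0" "h * real (Suc m) = b - a" using assms by (auto simp: h_def)
  define j where "j = nat (\<lceil>(u - a) / h\<rceil> - 1)"
  have "0 < (u - a) / h" using assms h by simp
  then have j: "real j < (u - a) / h" "(u - a) / h \<le> real (Suc j)"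
    unfolding j_def by linarith+
  have "u - a \<le> real (Suc m) * h" using h assms by (simp add: mult.commute)
  then have "(u - a) / h \<le> real (Suc m)" using h(1) by (simp add: field_simps)
  then have "j \<le> m" using j(1) by linarith
  moreover have "u \<in> grid_cell a b m j"
    using j h(1) unfolding grid_cell_def grid_def h_def[symmetric]
    by (auto simp: pos_less_divide_eq pos_divide_le_eq)
  ultimately show ?thesis by (rule that)
qed

lemma grid_cell_unique:
  assumes "a < b" "u \<in> grid_cell a b m i" "u \<in> grid_cell a b m j"
  shows "i = j"
proof -
  define h where "h = (b - a) / real (Suc m)"
  have h: "h > 0" using assms by (auto simp: h_def)
  have "real i * h < real (Suc j) * h" "real j * h < real (Suc i) * h"
    using assms(2,3) unfolding grid_cell_def grid_def h_def[symmetric] by auto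
  then show ?thesis using h by (simp add: mult_less_cancel_right)
qed

lemma grid_LIMSEQ:
  assumes u: "a < u" "u \<le> b" and j: "\<And>m. u \<in> grid_cell a b m (j m)"
  shows "(\<lambda>m. grid a b m (j m)) \<longlonglongrightarrow> u" "(\<lambda>m. grid a b m (Suc (j m))) \<longlonglongrightarrow> u"
proof -
  have lim: "(\<lambda>m. (b - a) / real (Suc m)) \<longlonglongrightarrow> 0"
    using LIMSEQ_Suc[OF lim_const_over_n[of "b - a"]] by simp
  show "(\<lambda>m. grid a b m (j m)) \<longlonglongrightarrow> u"
  proof (rule tendsto_sandwich)
    show "\<forall>\<^sub>F m in sequentially. u - (b - a) / real (Suc m) \<le> grid a b m (j m)"
      using j by (intro always_eventually) (auto simp: grid_cell_def grid_Suc algebra_simps)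
    show "\<forall>\<^sub>F m in sequentially. grid a b m (j m) \<le> u"
      using j by (intro always_eventually) (auto simp: grid_cell_def intro: less_imp_le)
    show "(\<lambda>m. u - (b - a) / real (Suc m)) \<longlonglongrightarrow> u"
      using tendsto_diff[OF tendsto_const lim, of u] by simp
  qed simp
  from tendsto_add[OF this lim] show "(\<lambda>m. grid a b m (Suc (j m))) \<longlonglongrightarrow> u"
    by (simp add: grid_Suc)
qed

lemma grid_jump_LIMSEQ:
  assumes f: "cadlag f" and u: "0 \<le> a" "a < u" "u \<le> b" and j: "\<And>m. u \<in> grid_cell a b m (j m)"
  shows "(\<lambda>m. f (grid a b m (Suc (j m))) - f (grid a b m (j m))) \<longlonglongrightarrow> jump f u"
  using grid_LIMSEQ[OF u(2,3) j] j u
  by (intro jump_LIMSEQ[OF f]) (auto simp: grid_cell_def)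

text \<open>
  The jump at \<open>u\<close> as a limit of sums in which \<open>u\<close> enters only through indicators, so that a random
  time can be substituted for \<open>u\<close> without losing measurability.
\<close>

lemma grid_sum_jump_LIMSEQ:
  assumes f: "cadlag f" and u: "0 \<le> a" "a < u" "u \<le> b"
  shows "(\<lambda>m. \<Sum>j\<le>m. (f (grid a b m (Suc j)) - f (grid a b m j)) * indicator (grid_cell a b m j) u)
           \<longlonglongrightarrow> jump f u"
proof -
  have "\<forall>m. \<exists>j. j \<le> m \<and> u \<in> grid_cell a b m j" using in_grid_cell u by metis
  then obtain j where j: "\<And>m. j m \<le> m" "\<And>m. u \<in> grid_cell a b m (j m)" by metis
  have "(\<Sum>i\<le>m. (f (grid a b m (Suc i)) - f (grid a b m i)) * indicator (grid_cell a b m i) u)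
      = f (grid a b m (Suc (j m))) - f (grid a b m (j m))" for m
  proof -
    have "(\<Sum>i\<le>m. (f (grid a b m (Suc i)) - f (grid a b m i)) * indicator (grid_cell a b m i) u)
        = (\<Sum>i\<in>{j m}. (f (grid a b m (Suc i)) - f (grid a b m i)) * indicator (grid_cell a b m i) u)"
    proof (rule sum.mono_neutral_right)
      have "u \<notin> grid_cell a b m i" if "i \<noteq> j m" for i
        using grid_cell_unique[of a b u m i "j m"] j(2)[of m] u that by linarith
      then show "\<forall>i\<in>{..m} - {j m}.
          (f (grid a b m (Suc i)) - f (grid a b m i)) * indicator (grid_cell a b m i) u = 0"
        by simp
    qed (use j(1) in auto)
    then show ?thesis using j(2)[of m] by simp
  qed
  then show ?thesis using grid_jump_LIMSEQ[OF f u j(2)] by simp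
qed

lemma jump_le_liminf_grid_sum:
  assumes f: "cadlag f" and u: "0 \<le> a" "a < u" "u \<le> b"
    and \<phi>: "continuous_on UNIV \<phi>"
  shows "ennreal (\<phi> (jump f u))
    \<le> liminf (\<lambda>m. \<Sum>j\<le>m. ennreal (\<phi> (f (grid a b m (Suc j)) - f (grid a b m j))))"
proof -
  have "\<forall>m. \<exists>j. j \<le> m \<and> u \<in> grid_cell a b m j" using in_grid_cell u by metis
  then obtain j where j: "\<And>m. j m \<le> m" "\<And>m. u \<in> grid_cell a b m (j m)" by metis
  let ?t = "\<lambda>m i. ennreal (\<phi> (f (grid a b m (Suc i)) - f (grid a b m i)))"
  have "(\<lambda>m. ?t m (j m)) \<longlonglongrightarrow> ennreal (\<phi> (jump f u))"
    by (intro tendsto_ennrealI continuous_on_tendsto_compose[OF \<phi>] grid_jump_LIMSEQ f u j) auto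
  then have "ennreal (\<phi> (jump f u)) = liminf (\<lambda>m. ?t m (j m))"
    by (simp add: lim_imp_Liminf)
  also have "\<dots> \<le> liminf (\<lambda>m. \<Sum>i\<le>m. ?t m i)"
    using j(1) by (intro Liminf_mono always_eventually allI member_le_sum) auto
  finally show ?thesis .
qed

text \<open>
  Large jumps are visible from countably many increments. If increments above \<open>e + d\<close> persist in
  arbitrarily fine partitions, their cells accumulate at some \<open>x\<close>; by the oscillation bound they must
  straddle \<open>x\<close>, whose jump then exceeds \<open>e\<close>. The margin \<open>d\<close> compensates for the approximation.
\<close>

lemma exists_jump_gt_iff_grid:
  assumes f: "cadlag f" and ab: "0 \<le> a" "a < b" and e: "0 \<le> e"
  shows "(\<exists>u\<in>{a<..b}. e < jump f u) \<longleftrightarrow>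
    (\<exists>k n::nat. \<forall>m\<ge>n. \<exists>j\<le>m. e + 1 / real (Suc k) < f (grid a b m (Suc j)) - f (grid a b m j))"
    (is "?L \<longleftrightarrow> ?R")
proof
  assume ?L
  then obtain u where u: "a < u" "u \<le> b" "e < jump f u" by auto
  have "\<forall>m. \<exists>j. j \<le> m \<and> u \<in> grid_cell a b m j" using in_grid_cell u by metis
  then obtain j where j: "\<And>m. j m \<le> m" "\<And>m. u \<in> grid_cell a b m (j m)" by metis
  obtain k where "1 / real (Suc k) < jump f u - e"
    using reals_Archimedean[of "jump f u - e"] u(3) by (auto simp: inverse_eq_divide)
  then have "\<forall>\<^sub>F m in sequentially. e + 1 / real (Suc k) < f (grid a b m (Suc (j m))) - f (grid a b m (j m))"
    by (intro order_tendstoD(1)[OF grid_jump_LIMSEQ[OF f ab(1) u(1,2) j(2)]]) auto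
  then show ?R using j(1) unfolding eventually_sequentially by meson
next
  assume ?R
  then obtain k n where kn:
    "\<forall>m\<ge>n. \<exists>j\<le>m. e + 1 / real (Suc k) < f (grid a b m (Suc j)) - f (grid a b m j)" by blast
  define d where "d = 1 / real (Suc k)"
  have d: "d > 0" by (simp add: d_def)
  obtain j where j: "\<And>m. m \<ge> n \<Longrightarrow> j m \<le> m"
    "\<And>m. m \<ge> n \<Longrightarrow> e + d < f (grid a b m (Suc (j m))) - f (grid a b m (j m))"
    using kn unfolding d_def by metis
  define p where "p m = grid a b (m + n) (j (m + n))" for m
  have p: "p m \<in> {a..b}" for m
    using j(1)[of "m + n"] ab by (auto simp: p_def grid_ge grid_le)
  obtain x s where x: "x \<in> {a..b}" and s: "strict_mono (s::nat \<Rightarrow> nat)" "(p \<circ> s) \<longlonglongrightarrow> x"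
    using p compact_Icc[of a b] unfolding compact_def by metis
  obtain \<delta> where \<delta>: "\<delta> > 0"
    "\<And>p r. \<lbrakk>0 \<le> p; p < r; \<bar>p - x\<bar> < \<delta>; \<bar>r - x\<bar> < \<delta>\<rbrakk> \<Longrightarrow>
       f r - f p < d \<or> (p < x \<and> x \<le> r \<and> f r - f p < jump f x + d)"
    using cadlag_oscillation[OF f _ d, of x] x ab by auto
  define r where "r m = grid a b (m + n) (Suc (j (m + n)))" for m
  have "(\<lambda>m. (b - a) / real (Suc (m + n))) \<longlonglongrightarrow> 0"
    using LIMSEQ_ignore_initial_segment[OF lim_const_over_n[of "b - a"], of "Suc n"] by simp
  then have "(\<lambda>m. (p \<circ> s) m + ((\<lambda>m. (b - a) / real (Suc (m + n))) \<circ> s) m) \<longlonglongrightarrow> x + 0"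
    by (intro tendsto_add LIMSEQ_subseq_LIMSEQ[OF _ s(1)] s(2))
  then have "(\<lambda>m. r (s m)) \<longlonglongrightarrow> x"
    by (simp add: r_def p_def grid_Suc o_def)
  then have "\<forall>\<^sub>F m in sequentially. dist (r (s m)) x < \<delta> \<and> dist ((p \<circ> s) m) x < \<delta>"
    using s(2) \<delta>(1) by (intro eventually_conj tendstoD)
  then obtain m where m: "\<bar>r (s m) - x\<bar> < \<delta>" "\<bar>p (s m) - x\<bar> < \<delta>"
    by (auto simp: eventually_sequentially dist_real_def)
  have pr: "a \<le> p (s m)" "p (s m) < r (s m)" "e + d < f (r (s m)) - f (p (s m))"
    using p[of "s m"] j(2)[of "s m + n"] ab by (auto simp: p_def r_def grid_Suc)
  then have "p (s m) < x" "e < jump f x"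
    using \<delta>(2)[of "p (s m)" "r (s m)"] m ab e by auto
  then show ?L using pr x by (intro bexI[of _ x]) auto
qed

section \<open>The first large jump in an interval\<close>

text \<open>
  The value \<open>b\<close> when no jump exceeds \<open>e\<close> keeps the time inside \<open>{a<..b}\<close>, so that the estimates
  for the jump at this time hold on the whole sample space.
\<close>

definition first_jump :: "real \<Rightarrow> real \<Rightarrow> real \<Rightarrow> (real \<Rightarrow> real) \<Rightarrow> real" where
  "first_jump e a b f = Min (insert b {u\<in>{a<..b}. e < jump f u})"

lemma finite_jumps_gt_Ioc:
  "cadlag f \<Longrightarrow> 0 < e \<Longrightarrow> 0 \<le> a \<Longrightarrow> finite {u\<in>{a<..b}. e < jump f u}"
  by (rule finite_subset[OF _ finite_jumps_gt[of f e b]]) auto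

lemma first_jump_in:
  assumes "cadlag f" "0 < e" "0 \<le> a" "a < b"
  shows "first_jump e a b f \<in> {a<..b}"
  using Min_in[of "insert b {u\<in>{a<..b}. e < jump f u}"] finite_jumps_gt_Ioc[OF assms(1-3), of b] assms(4)
  unfolding first_jump_def by auto

lemma first_jump_le_iff:
  assumes "cadlag f" "0 < e" "0 \<le> a" "y < b"
  shows "first_jump e a b f \<le> y \<longleftrightarrow> (\<exists>u\<in>{a<..y}. e < jump f u)"
  unfolding first_jump_def using assms(4)
  using finite_jumps_gt_Ioc[OF assms(1-3), of b] by (subst Min_le_iff) auto

lemma jump_first_jump:
  assumes "cadlag f" "0 < e" "0 \<le> a" "\<exists>u\<in>{a<..b}. e < jump f u"
  shows "e < jump f (first_jump e a b f)"
proof -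
  let ?J = "{u\<in>{a<..b}. e < jump f u}"
  have fin: "finite ?J" using finite_jumps_gt_Ioc[OF assms(1-3)] .
  have ne: "?J \<noteq> {}" using assms(4) by blast
  then have "Min ?J \<in> ?J" using fin by (rule Min_in[rotated])
  moreover from this have "Min (insert b ?J) = Min ?J"
    using Min_insert[OF fin ne, of b] by (simp add: min_def)
  ultimately show ?thesis unfolding first_jump_def by simp
qed

lemma first_jump_unique:
  assumes "u \<in> {a<..b}" "e < jump f u" "\<And>v. v \<in> {a<..b} \<Longrightarrow> e < jump f v \<Longrightarrow> v = u"
  shows "first_jump e a b f = u"
proof -
  have "{u\<in>{a<..b}. e < jump f u} = {u}" using assms by blast
  then show ?thesis using assms(1) by (simp add: first_jump_def)
qed

text \<open>
  The times of jumps larger than \<open>e\<close> are finitely many. Once the cells are shorter than the distance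
  from \<open>u\<close> to the others, \<open>u\<close> is alone in its cell and is selected there.
\<close>

lemma eventually_first_jump_grid:
  assumes f: "cadlag f" and e: "0 < e" and u: "u \<in> {0<..b}" "e < jump f u"
  shows "\<forall>\<^sub>F n in sequentially. \<exists>i\<le>n. u \<in> grid_cell 0 b n i \<and>
    first_jump e (grid 0 b n i) (grid 0 b n (Suc i)) f = u"
proof -
  let ?J = "{v\<in>{0<..b}. e < jump f v}"
  have "finite (?J - {u})" using finite_jumps_gt[OF f e] by simp
  then obtain d where d: "d > 0" "\<And>v. v \<in> ?J \<Longrightarrow> v \<noteq> u \<Longrightarrow> d \<le> dist u v"
    using finite_set_avoid[of "?J - {u}" u] by auto
  have "(\<lambda>n. b / real (Suc n)) \<longlonglongrightarrow> 0"
    using LIMSEQ_Suc[OF lim_const_over_n[of b]] by simp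
  then have "\<forall>\<^sub>F n in sequentially. b / real (Suc n) < d"
    using d(1) by (rule order_tendstoD)
  then show ?thesis
  proof eventually_elim
    case (elim n)
    obtain i where i: "i \<le> n" "u \<in> grid_cell 0 b n i" using in_grid_cell[of 0 u b] u by auto
    have "first_jump e (grid 0 b n i) (grid 0 b n (Suc i)) f = u"
    proof (rule first_jump_unique)
      fix v assume v: "v \<in> {grid 0 b n i<..grid 0 b n (Suc i)}" "e < jump f v"
      have "0 < v" "v \<le> b"
        using v(1) grid_ge[of 0 b n i] grid_le[of 0 b "Suc i" n] u i by auto
      moreover have "dist u v < d"
        using v(1) i(2) elim by (auto simp: grid_cell_def grid_Suc dist_real_def)
      ultimately show "v = u" using d(2)[of v] v(2) by fastforce
    qed (use i u in \<open>auto simp: grid_cell_def\<close>)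
    with i show ?case by blast
  qed
qed

section \<open>Measurability with respect to the process\<close>

lemma measurable_process_algebra:
  assumes "0 \<le> t"
  shows "X t \<in> borel_measurable (process_algebra M X)"
proof -
  have "(\<lambda>\<omega>. \<lambda>t\<in>{0..}. X t \<omega>) \<in> process_algebra M X \<rightarrow>\<^sub>M Pi\<^sub>M {0..} (\<lambda>_. borel)"
    unfolding process_algebra_def by (rule measurable_vimage_algebra1) (auto simp: space_PiM)
  from measurable_compose[OF this measurable_component_singleton[of t]]
  show ?thesis using assms by simp
qed

lemma space_process_algebra [simp]: "space (process_algebra M X) = space M"
  by (simp add: process_algebra_def)

lemma sets_process_algebra_subset:
  assumes "levy_process M X"
  shows "sets (process_algebra M X) \<subseteq> sets M"
  unfolding process_algebra_def
proof (rule sets_image_in_sets[OF refl])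
  show "(\<lambda>\<omega>. \<lambda>t\<in>{0..}. X t \<omega>) \<in> M \<rightarrow>\<^sub>M Pi\<^sub>M {0..} (\<lambda>_. borel)"
    using assms by (intro measurable_restrict) (auto simp: levy_process_def)
qed

lemma measurable_from_process_algebra:
  assumes "levy_process M X" "f \<in> process_algebra M X \<rightarrow>\<^sub>M R"
  shows "f \<in> M \<rightarrow>\<^sub>M R"
  using assms(2) sets_process_algebra_subset[OF assms(1)]
  by (auto simp: measurable_def)

lemma sets_exists_jump_gt:
  assumes "\<And>\<omega>. \<omega> \<in> space M \<Longrightarrow> cadlag (\<lambda>t. X t \<omega>)" and ab: "0 \<le> a" "a < b" and e: "0 \<le> e"
  shows "{\<omega>\<in>space M. \<exists>u\<in>{a<..b}. e < jump (\<lambda>t. X t \<omega>) u} \<in> sets (process_algebra M X)"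
proof -
  let ?P = "process_algebra M X"
  have [measurable]: "X (grid a b m j) \<in> borel_measurable ?P" for m j
    using ab by (intro measurable_process_algebra order_trans[OF _ grid_ge]) auto
  have "{\<omega>\<in>space ?P. \<exists>k n::nat. \<forall>m\<ge>n. \<exists>j\<le>m.
      e + 1 / real (Suc k) < X (grid a b m (Suc j)) \<omega> - X (grid a b m j) \<omega>} \<in> sets ?P"
    by measurable
  also have "{\<omega>\<in>space ?P. \<exists>k n::nat. \<forall>m\<ge>n. \<exists>j\<le>m.
      e + 1 / real (Suc k) < X (grid a b m (Suc j)) \<omega> - X (grid a b m j) \<omega>}
    = {\<omega>\<in>space M. \<exists>u\<in>{a<..b}. e < jump (\<lambda>t. X t \<omega>) u}"
    by (intro Collect_cong conj_cong) (simp_all add: exists_jump_gt_iff_grid[OF assms(1) ab e])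
  finally show ?thesis .
qed

lemma measurable_first_jump:
  assumes X: "\<And>\<omega>. \<omega> \<in> space M \<Longrightarrow> cadlag (\<lambda>t. X t \<omega>)" and ab: "0 \<le> a" "a < b" and e: "0 < e"
  shows "(\<lambda>\<omega>. first_jump e a b (\<lambda>t. X t \<omega>)) \<in> borel_measurable (process_algebra M X)"
  unfolding borel_measurable_iff_le
proof
  fix y
  let ?P = "process_algebra M X"
  let ?S = "{\<omega>\<in>space ?P. first_jump e a b (\<lambda>t. X t \<omega>) \<le> y}"
  consider "b \<le> y" | "y \<le> a" | "a < y" "y < b" by linarith
  then show "?S \<in> sets ?P"
  proof cases
    case 1
    then have "?S = space ?P"
      using first_jump_in[OF X e ab] by fastforce
    then show ?thesis by (metis sets.top)
  next
    case 2
    then have "?S = {}"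
      using first_jump_in[OF X e ab] by fastforce
    then show ?thesis by (metis sets.empty_sets)
  next
    case 3
    then have "?S = {\<omega>\<in>space M. \<exists>u\<in>{a<..y}. e < jump (\<lambda>t. X t \<omega>) u}"
      using first_jump_le_iff[OF X e ab(1)] by auto
    then show ?thesis using sets_exists_jump_gt[where M = M and X = X and a = a and b = y and e = e] X ab(1) 3(1) e by simp
  qed
qed

lemma measurable_jump_at:
  assumes X: "\<And>\<omega>. \<omega> \<in> space M \<Longrightarrow> cadlag (\<lambda>t. X t \<omega>)" and a: "0 \<le> a"
    and \<tau>: "\<tau> \<in> borel_measurable (process_algebra M X)" "\<And>\<omega>. \<omega> \<in> space M \<Longrightarrow> \<tau> \<omega> \<in> {a<..b}"
  shows "(\<lambda>\<omega>. jump (\<lambda>t. X t \<omega>) (\<tau> \<omega>)) \<in> borel_measurable (process_algebra M X)"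
proof (cases "a < b")
  case True
  let ?P = "process_algebra M X"
  have [measurable]: "X (grid a b m j) \<in> borel_measurable ?P" for m j
    using a True by (intro measurable_process_algebra order_trans[OF _ grid_ge]) auto
  note \<tau>(1)[measurable]
  have [measurable]: "grid_cell a b m j \<in> sets borel" for m j by (simp add: grid_cell_def)
  show ?thesis
  proof (rule borel_measurable_LIMSEQ_real)
    show "(\<lambda>m. \<Sum>j\<le>m. (X (grid a b m (Suc j)) \<omega> - X (grid a b m j) \<omega>) * indicator (grid_cell a b m j) (\<tau> \<omega>))
        \<longlonglongrightarrow> jump (\<lambda>t. X t \<omega>) (\<tau> \<omega>)" if "\<omega> \<in> space ?P" for \<omega>
      using that \<tau>(2)[of \<omega>] X[of \<omega>] a by (intro grid_sum_jump_LIMSEQ) auto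
  qed measurable
next
  case False
  then have "space M = {}" using \<tau>(2) by force
  then show ?thesis by (simp add: measurable_def)
qed

section \<open>The weight of jumps and increments\<close>

text \<open>
  Comparable to the square for bounded \<open>x \<ge> 0\<close>, and a linear combination of \<open>1\<close>, \<open>e\<^bsup>-x\<^esup>\<close> and
  \<open>e\<^bsup>-2x\<^esup>\<close>, so that the Laplace exponent determines its expectation exactly.
\<close>

definition jump_weight :: "real \<Rightarrow> real" where
  "jump_weight x = (1 - exp (- x))\<^sup>2"

lemma borel_measurable_jump_weight [measurable]: "jump_weight \<in> borel_measurable borel"
  unfolding jump_weight_def by measurable

lemma square_le_jump_weight:
  assumes "0 \<le> x" "x \<le> L"
  shows "x\<^sup>2 \<le> exp (2 * L) * jump_weight x"
proof -
  have "x * exp (- L) \<le> x * exp (- x)"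
    using assms by (intro mult_left_mono) auto
  also have "\<dots> \<le> 1 - exp (- x)"
    using mult_right_mono[OF exp_ge_add_one_self[of x], of "exp (- x)"]
    by (simp add: exp_minus_inverse algebra_simps)
  finally have "(x * exp (- L))\<^sup>2 \<le> jump_weight x"
    unfolding jump_weight_def using assms by (intro power_mono) auto
  moreover have "(exp L)\<^sup>2 = exp (2 * L)" by (simp add: exp_double)
  ultimately have "(exp L)\<^sup>2 * (x * exp (- L))\<^sup>2 \<le> exp (2 * L) * jump_weight x"
    by simp
  moreover have "(exp L)\<^sup>2 * (x * exp (- L))\<^sup>2 = x\<^sup>2"
    by (simp add: power_mult_distrib exp_minus field_simps)
  ultimately show ?thesis by simp
qed

lemma nn_integral_increment_weight:
  assumes X: "levy_process M X" and \<psi>: "has_laplace_exponent M X \<psi>" and sh: "0 \<le> s" "0 \<le> h"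
  shows "(\<integral>\<^sup>+\<omega>. ennreal (jump_weight (X (s + h) \<omega> - X s \<omega>)) \<partial>M)
       = ennreal (exp (h * \<psi> 2) - 2 * exp (h * \<psi> 1) + 1)"
proof -
  interpret prob_space M using X by (simp add: levy_process_def)
  have [measurable]: "X s \<in> borel_measurable M" "X h \<in> borel_measurable M" "X (s + h) \<in> borel_measurable M"
    using X sh by (auto simp: levy_process_def)
  have "(\<integral>\<^sup>+\<omega>. ennreal (jump_weight (X (s + h) \<omega> - X s \<omega>)) \<partial>M)
      = (\<integral>\<^sup>+x. ennreal (jump_weight x) \<partial>distr M borel (\<lambda>\<omega>. X (s + h) \<omega> - X s \<omega>))"
    by (subst nn_integral_distr) auto
  also have "distr M borel (\<lambda>\<omega>. X (s + h) \<omega> - X s \<omega>) = distr M borel (X h)"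
    using X sh by (auto simp: levy_process_def)
  also have "(\<integral>\<^sup>+x. ennreal (jump_weight x) \<partial>distr M borel (X h)) = (\<integral>\<^sup>+\<omega>. ennreal (jump_weight (X h \<omega>)) \<partial>M)"
    by (subst nn_integral_distr) auto
  also have "\<dots> = ennreal (exp (h * \<psi> 2) - 2 * exp (h * \<psi> 1) + 1)"
  proof -
    have "has_bochner_integral M (\<lambda>\<omega>. exp (- 2 * X h \<omega>)) (exp (h * \<psi> 2))"
      "has_bochner_integral M (\<lambda>\<omega>. exp (- 1 * X h \<omega>)) (exp (h * \<psi> 1))"
      using \<psi> sh unfolding has_laplace_exponent_def by (metis zero_le_numeral, metis zero_le_one)
    moreover have "has_bochner_integral M (\<lambda>_. 1::real) 1"
      by (simp add: has_bochner_integral_iff prob_space)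
    ultimately have "has_bochner_integral M
        (\<lambda>\<omega>. exp (- 2 * X h \<omega>) - 2 * exp (- 1 * X h \<omega>) + 1) (exp (h * \<psi> 2) - 2 * exp (h * \<psi> 1) + 1)"
      by (intro has_bochner_integral_add has_bochner_integral_diff has_bochner_integral_mult_right)
    also have "(\<lambda>\<omega>. exp (- 2 * X h \<omega>) - 2 * exp (- 1 * X h \<omega>) + 1) = (\<lambda>\<omega>. jump_weight (X h \<omega>))"
      by (simp add: fun_eq_iff jump_weight_def power2_eq_square algebra_simps flip: exp_add)
    finally show ?thesis
      by (simp add: has_bochner_integral_iff nn_integral_eq_integral jump_weight_def)
  qed
  finally show ?thesis .
qed

text \<open>
  The left-hand side vanishes at \<open>h = 0\<close>, so it is at most linear on \<open>[0, T]\<close>; this makes the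
  expected weight of an increment proportional to the length of its time interval.
\<close>

lemma exp_second_difference_le:
  fixes c h T :: real
  assumes "0 \<le> c" "0 \<le> h" "h \<le> T"
  shows "exp (h * c) - 2 * exp h + 1 \<le> c * exp (c * T) * h"
proof -
  have "exp (h * c) - 1 \<le> (h * c) * exp (h * c)"
    using mult_right_mono[OF exp_ge_add_one_self[of "- (h * c)"], of "exp (h * c)"]
    by (simp add: algebra_simps flip: exp_add)
  also have "\<dots> \<le> (h * c) * exp (c * T)"
    using assms mult_right_mono[OF assms(3,1)] by (intro mult_left_mono) (auto simp: mult.commute)
  moreover have "1 \<le> exp h" using assms by simp
  ultimately have "exp (h * c) - 2 * exp h + 1 \<le> (h * c) * exp (c * T)" by linarith
  then show ?thesis by (simp add: mult_ac)
qed

text \<open>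
  The weight of the selected jump is at most the limit inferior of the sums of the weights of the
  increments over a partition of \<open>{a<..b}\<close>, whose expectations are at most \<open>S * (b - a)\<close>; apply
  Fatou's lemma.
\<close>

lemma nn_integral_jump_weight_le:
  assumes X: "levy_process M X" and ab: "0 \<le> a" "a < b" and S: "0 \<le> S"
    and incr: "\<And>s h. 0 \<le> s \<Longrightarrow> 0 \<le> h \<Longrightarrow> h \<le> b - a \<Longrightarrow>
      (\<integral>\<^sup>+\<omega>. ennreal (jump_weight (X (s + h) \<omega> - X s \<omega>)) \<partial>M) \<le> ennreal (S * h)"
    and \<tau>: "\<And>\<omega>. \<omega> \<in> space M \<Longrightarrow> \<tau> \<omega> \<in> {a<..b}"
  shows "(\<integral>\<^sup>+\<omega>. ennreal (jump_weight (jump (\<lambda>t. X t \<omega>) (\<tau> \<omega>))) \<partial>M) \<le> ennreal (S * (b - a))"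
proof -
  have [measurable]: "X (grid a b m j) \<in> borel_measurable M" for m j
    using X ab order_trans[OF ab(1) grid_ge[of a b m j]] by (auto simp: levy_process_def)
  let ?I = "\<lambda>m j \<omega>. ennreal (jump_weight (X (grid a b m (Suc j)) \<omega> - X (grid a b m j) \<omega>))"
  have "(\<integral>\<^sup>+\<omega>. ennreal (jump_weight (jump (\<lambda>t. X t \<omega>) (\<tau> \<omega>))) \<partial>M)
      \<le> (\<integral>\<^sup>+\<omega>. liminf (\<lambda>m. \<Sum>j\<le>m. ?I m j \<omega>) \<partial>M)"
  proof (intro nn_integral_mono jump_le_liminf_grid_sum)
    show "continuous_on UNIV jump_weight"
      unfolding jump_weight_def by (intro continuous_intros)
  qed (use X \<tau> ab in \<open>auto simp: levy_process_def\<close>)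
  also have "\<dots> \<le> liminf (\<lambda>m. \<integral>\<^sup>+\<omega>. (\<Sum>j\<le>m. ?I m j \<omega>) \<partial>M)"
    by (intro nn_integral_liminf) measurable
  also have "\<dots> \<le> liminf (\<lambda>m. ennreal (S * (b - a)))"
  proof (intro Liminf_mono always_eventually allI)
    fix m
    let ?h = "(b - a) / real (Suc m)"
    have h: "0 \<le> ?h" "?h \<le> b - a"
      using ab divide_left_mono[of 1 "real (Suc m)" "b - a"] by auto
    have "(\<integral>\<^sup>+\<omega>. (\<Sum>j\<le>m. ?I m j \<omega>) \<partial>M) = (\<Sum>j\<le>m. \<integral>\<^sup>+\<omega>. ?I m j \<omega> \<partial>M)"
      by (intro nn_integral_sum) measurable
    also have "\<dots> \<le> (\<Sum>j\<le>m. ennreal (S * ?h))"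
      unfolding grid_Suc using h ab order_trans[OF ab(1) grid_ge] by (intro sum_mono incr) auto
    also have "\<dots> = ennreal (S * (b - a))"
      using h S by (simp add: ennreal_of_nat_eq_real_of_nat ennreal_mult' [symmetric] del: of_nat_Suc)
    finally show "(\<integral>\<^sup>+\<omega>. (\<Sum>j\<le>m. ?I m j \<omega>) \<partial>M) \<le> ennreal (S * (b - a))" .
  qed
  also have "\<dots> = ennreal (S * (b - a))" by (simp add: Liminf_const)
  finally show ?thesis .
qed

section \<open>Marks of selected jumps\<close>

text \<open>
  The kernel enters through the lower bound \<open>1 - w\<close>, which is measurable, so that no measurability
  of \<open>x \<mapsto> \<kappa> x B\<close> has to be established.
\<close>

lemma emeasure_marks_notin_le:
  assumes X: "levy_process M X" and marked: "marked_process M X \<kappa> Zm"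
    and A: "A \<in> sets (process_algebra M X)" and \<tau>: "\<tau> \<in> borel_measurable (process_algebra M X)"
    and jmp: "\<And>\<omega>. \<omega> \<in> A \<Longrightarrow> 0 \<le> \<tau> \<omega> \<and> 0 < jump (\<lambda>t. X t \<omega>) (\<tau> \<omega>)"
    and B: "B \<in> sets path_space" and w: "w \<in> borel_measurable M"
    and \<kappa>: "\<And>\<omega>. \<omega> \<in> A \<Longrightarrow> 1 \<le> emeasure (\<kappa> (jump (\<lambda>t. X t \<omega>) (\<tau> \<omega>))) B + w \<omega>"
  shows "{\<omega>\<in>A. Zm (\<tau> \<omega>) \<omega> \<notin> B} \<in> sets M"
    and "emeasure M {\<omega>\<in>A. Zm (\<tau> \<omega>) \<omega> \<notin> B} \<le> (\<integral>\<^sup>+\<omega>\<in>A. w \<omega> \<partial>M)"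
proof -
  interpret prob_space M using X by (simp add: levy_process_def)
  have AM [measurable]: "A \<in> sets M" using A sets_process_algebra_subset[OF X] by blast
  note w[measurable]
  let ?G = "{\<omega>\<in>A. Zm (\<tau> \<omega>) \<omega> \<in> B}"
  have G: "?G \<in> sets M" "emeasure M ?G = (\<integral>\<^sup>+\<omega>\<in>A. emeasure (\<kappa> (jump (\<lambda>t. X t \<omega>) (\<tau> \<omega>))) B \<partial>M)"
    using marked[unfolded marked_process_def, rule_format, of A 1 "\<lambda>_. \<tau>" "\<lambda>_. B"] A \<tau> jmp B
    by (auto simp: inj_on_def)
  have eq: "{\<omega>\<in>A. Zm (\<tau> \<omega>) \<omega> \<notin> B} = A - ?G" by auto
  then show bad: "{\<omega>\<in>A. Zm (\<tau> \<omega>) \<omega> \<notin> B} \<in> sets M" using G(1) AM by simp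
  have "emeasure M {\<omega>\<in>A. Zm (\<tau> \<omega>) \<omega> \<notin> B} + emeasure M ?G = emeasure M A"
    using G(1) bad by (subst plus_emeasure) (auto intro!: arg_cong[where f = "emeasure M"])
  also have "emeasure M A = (\<integral>\<^sup>+\<omega>. indicator A \<omega> \<partial>M)" by simp
  also have "\<dots> \<le> (\<integral>\<^sup>+\<omega>. w \<omega> * indicator A \<omega> + (1 - w \<omega>) * indicator A \<omega> \<partial>M)"
  proof (rule nn_integral_mono)
    fix \<omega>
    have "1 \<le> w \<omega> + (1 - w \<omega>)"
      by (cases "w \<omega> \<le> 1") (auto simp: add_diff_inverse_ennreal intro: add_increasing2)
    then show "indicator A \<omega> \<le> w \<omega> * indicator A \<omega> + (1 - w \<omega>) * indicator A \<omega>"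
      by (auto simp: indicator_def)
  qed
  also have "\<dots> = (\<integral>\<^sup>+\<omega>\<in>A. w \<omega> \<partial>M) + (\<integral>\<^sup>+\<omega>\<in>A. 1 - w \<omega> \<partial>M)"
    by (intro nn_integral_add) measurable
  also have "\<dots> \<le> (\<integral>\<^sup>+\<omega>\<in>A. w \<omega> \<partial>M) + emeasure M ?G"
    unfolding G(2)
  proof (intro add_left_mono nn_integral_mono)
    fix \<omega>
    have "1 - w \<omega> \<le> emeasure (\<kappa> (jump (\<lambda>t. X t \<omega>) (\<tau> \<omega>))) B" if "\<omega> \<in> A"
      using ennreal_minus_mono[OF \<kappa>[OF that] order_refl, of "w \<omega>"] \<kappa>[OF that]
      by (cases "w \<omega> = \<top>") (auto simp: diff_eq_0_ennreal)
    then show "(1 - w \<omega>) * indicator A \<omega> \<le> emeasure (\<kappa> (jump (\<lambda>t. X t \<omega>) (\<tau> \<omega>))) B * indicator A \<omega>"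
      by (auto simp: indicator_def)
  qed
  finally show "emeasure M {\<omega>\<in>A. Zm (\<tau> \<omega>) \<omega> \<notin> B} \<le> (\<integral>\<^sup>+\<omega>\<in>A. w \<omega> \<partial>M)"
    by (simp add: add.commute[of _ "emeasure M ?G"] ennreal_add_left_cancel_le)
qed

lemma emeasure_eventually_in_le:
  assumes F: "\<And>n::nat. F n \<in> sets M" "\<And>n. emeasure M (F n) \<le> c"
  shows "{\<omega>\<in>space M. \<forall>\<^sub>F n in sequentially. \<omega> \<in> F n} \<in> sets M"
    and "emeasure M {\<omega>\<in>space M. \<forall>\<^sub>F n in sequentially. \<omega> \<in> F n} \<le> c"
proof -
  let ?I = "\<lambda>n. \<Inter>m\<in>{n..}. F m"
  have I: "?I n \<in> sets M" for n using F(1) by (intro sets.countable_INT) auto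
  have eq: "{\<omega>\<in>space M. \<forall>\<^sub>F n in sequentially. \<omega> \<in> F n} = (\<Union>n. ?I n)"
    using sets.sets_into_space[OF F(1)] by (auto simp: eventually_sequentially)
  show "{\<omega>\<in>space M. \<forall>\<^sub>F n in sequentially. \<omega> \<in> F n} \<in> sets M"
    unfolding eq using I by blast
  have "emeasure M (\<Union>n. ?I n) = (SUP n. emeasure M (?I n))"
    using I by (intro SUP_emeasure_incseq[symmetric]) (auto simp: incseq_def)
  also have "\<dots> \<le> c"
  proof (rule SUP_least)
    fix n
    have "emeasure M (?I n) \<le> emeasure M (F n)" using F(1) by (intro emeasure_mono) auto
    then show "emeasure M (?I n) \<le> c" using F(2) by (rule order_trans)
  qed
  finally show "emeasure M {\<omega>\<in>space M. \<forall>\<^sub>F n in sequentially. \<omega> \<in> F n} \<le> c"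
    unfolding eq .
qed

text \<open>
  Think of \<open>B k\<close> as the paths that are good at level \<open>k\<close>. A mark outside \<open>B k\<close> has probability at
  most \<open>c k\<close> times the weight of its jump. Summing over the cells of \<open>{0<..T}\<close> bounds the probability
  that some jump of size at most \<open>L\<close> has a bad mark at level \<open>k\<close> by \<open>c k * S * T\<close>, which tends to \<open>0\<close>.
\<close>

lemma AE_marks_of_small_jumps_in_some:
  fixes B :: "nat \<Rightarrow> (real \<Rightarrow> real) set" and c :: "nat \<Rightarrow> real"
  assumes X: "levy_process M X" and marked: "marked_process M X \<kappa> Zm"
    and T: "0 < T" and S: "0 \<le> S"
    and incr: "\<And>s h. 0 \<le> s \<Longrightarrow> 0 \<le> h \<Longrightarrow> h \<le> T \<Longrightarrow>
      (\<integral>\<^sup>+\<omega>. ennreal (jump_weight (X (s + h) \<omega> - X s \<omega>)) \<partial>M) \<le> ennreal (S * h)"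
    and B: "\<And>k. B k \<in> sets path_space" and c: "\<And>k. 0 \<le> c k" "c \<longlonglongrightarrow> 0"
    and \<kappa>: "\<And>k x. 0 < x \<Longrightarrow> x \<le> L \<Longrightarrow> 1 \<le> emeasure (\<kappa> x) (B k) + ennreal (c k * jump_weight x)"
  shows "AE \<omega> in M. \<exists>k. \<forall>t\<in>{0<..T}. 0 < jump (\<lambda>t. X t \<omega>) t \<longrightarrow> jump (\<lambda>t. X t \<omega>) t \<le> L \<longrightarrow>
    Zm t \<omega> \<in> B k"
proof -
  have cadlag: "cadlag (\<lambda>t. X t \<omega>)" if "\<omega> \<in> space M" for \<omega>
    using X that by (simp add: levy_process_def)
  let ?J = "\<lambda>\<omega>. jump (\<lambda>t. X t \<omega>)"
  let ?P = "process_algebra M X"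
  define e :: "nat \<Rightarrow> real" where "e m = 1 / real (Suc m)" for m
  have e: "0 < e m" for m by (simp add: e_def)
  have g: "0 \<le> grid 0 T n i" "grid 0 T n i < grid 0 T n (Suc i)" for n i
    using T by (auto simp: grid_ge grid_Suc)
  define \<tau> where "\<tau> m n i \<omega> = first_jump (e m) (grid 0 T n i) (grid 0 T n (Suc i)) (\<lambda>t. X t \<omega>)" for m n i \<omega>
  have \<tau>_in: "\<tau> m n i \<omega> \<in> {grid 0 T n i<..grid 0 T n (Suc i)}" if "\<omega> \<in> space M" for m n i \<omega>
    unfolding \<tau>_def by (rule first_jump_in[OF cadlag[OF that] e g])
  have \<tau>_meas [measurable]: "\<tau> m n i \<in> borel_measurable ?P" for m n i
    unfolding \<tau>_def by (rule measurable_first_jump[OF cadlag g e])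
  have J_meas [measurable]: "(\<lambda>\<omega>. ?J \<omega> (\<tau> m n i \<omega>)) \<in> borel_measurable ?P" for m n i
    by (rule measurable_jump_at[OF cadlag g(1) \<tau>_meas \<tau>_in])
  define A where "A m n i = {\<omega>\<in>space M. (\<exists>u\<in>{grid 0 T n i<..grid 0 T n (Suc i)}. e m < ?J \<omega> u)}
      \<inter> {\<omega>\<in>space ?P. ?J \<omega> (\<tau> m n i \<omega>) \<le> L}" for m n i
  have A_sets: "A m n i \<in> sets ?P" for m n i
    unfolding A_def by (intro sets.Int sets_exists_jump_gt[OF cadlag g] less_imp_le[OF e]) measurable
  have A_jump: "0 < ?J \<omega> (\<tau> m n i \<omega>)" "?J \<omega> (\<tau> m n i \<omega>) \<le> L" "\<omega> \<in> space M" if "\<omega> \<in> A m n i" for m n i \<omega>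
  proof -
    show w: "\<omega> \<in> space M" and "?J \<omega> (\<tau> m n i \<omega>) \<le> L" using that by (auto simp: A_def)
    have "e m < ?J \<omega> (\<tau> m n i \<omega>)"
      using that unfolding \<tau>_def A_def by (intro jump_first_jump[OF cadlag[OF w] e g(1)]) auto
    then show "0 < ?J \<omega> (\<tau> m n i \<omega>)" using e[of m] by linarith
  qed
  define bad where "bad k m n i = {\<omega>\<in>A m n i. Zm (\<tau> m n i \<omega>) \<omega> \<notin> B k}" for k m n i
  have bad: "bad k m n i \<in> sets M \<and> emeasure M (bad k m n i) \<le> ennreal (c k * S * (T / real (Suc n)))"
    if "i \<le> n" for k m n i
  proof -
    let ?w = "\<lambda>\<omega>. ennreal (c k * jump_weight (?J \<omega> (\<tau> m n i \<omega>)))"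
    have [measurable]: "(\<lambda>\<omega>. ?J \<omega> (\<tau> m n i \<omega>)) \<in> borel_measurable M"
      by (rule measurable_from_process_algebra[OF X J_meas])
    have w: "?w \<in> borel_measurable M" by measurable
    have pos: "0 \<le> \<tau> m n i \<omega> \<and> 0 < ?J \<omega> (\<tau> m n i \<omega>)" if "\<omega> \<in> A m n i" for \<omega>
      using A_jump[OF that] \<tau>_in[OF A_jump(3)[OF that], of m n i] g(1)[of n i] by auto
    have 1: "1 \<le> emeasure (\<kappa> (?J \<omega> (\<tau> m n i \<omega>))) (B k) + ?w \<omega>" if "\<omega> \<in> A m n i" for \<omega>
      using A_jump[OF that] by (intro \<kappa>)
    have "T / real (Suc n) \<le> T" using T divide_left_mono[of 1 "real (Suc n)" T] by simp
    then have incr': "(\<integral>\<^sup>+\<omega>. ennreal (jump_weight (X (s + h) \<omega> - X s \<omega>)) \<partial>M) \<le> ennreal (S * h)"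
      if "0 \<le> s" "0 \<le> h" "h \<le> grid 0 T n (Suc i) - grid 0 T n i" for s h
      using that by (intro incr) (auto simp: grid_Suc)
    have bad_sets: "bad k m n i \<in> sets M"
      unfolding bad_def by (rule emeasure_marks_notin_le(1)[OF X marked A_sets \<tau>_meas pos B w 1])
    have "emeasure M (bad k m n i) \<le> (\<integral>\<^sup>+\<omega>\<in>A m n i. ?w \<omega> \<partial>M)"
      unfolding bad_def by (rule emeasure_marks_notin_le(2)[OF X marked A_sets \<tau>_meas pos B w 1])
    also have "(\<integral>\<^sup>+\<omega>\<in>A m n i. ?w \<omega> \<partial>M) \<le> (\<integral>\<^sup>+\<omega>. ennreal (c k) * ennreal (jump_weight (?J \<omega> (\<tau> m n i \<omega>))) \<partial>M)"
      using c(1) by (intro nn_integral_mono) (auto simp: indicator_def ennreal_mult')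
    also have "\<dots> = ennreal (c k) * (\<integral>\<^sup>+\<omega>. ennreal (jump_weight (?J \<omega> (\<tau> m n i \<omega>))) \<partial>M)"
      by (intro nn_integral_cmult) measurable
    also have "\<dots> \<le> ennreal (c k) * ennreal (S * (grid 0 T n (Suc i) - grid 0 T n i))"
      by (intro mult_left_mono nn_integral_jump_weight_le[OF X g S incr' \<tau>_in]) auto
    also have "\<dots> = ennreal (c k * S * (T / real (Suc n)))"
      using c(1) S T by (simp add: grid_Suc mult.assoc flip: ennreal_mult')
    finally show ?thesis using bad_sets by blast
  qed
  define F where "F k m n = (\<Union>i\<le>n. bad k m n i)" for k m n
  have F: "F k m n \<in> sets M" "emeasure M (F k m n) \<le> ennreal (c k * S * T)" for k m n
  proof -
    show "F k m n \<in> sets M" unfolding F_def using bad by (intro sets.finite_UN) auto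
    have "emeasure M (F k m n) \<le> (\<Sum>i\<le>n. emeasure M (bad k m n i))"
      unfolding F_def using bad by (intro emeasure_subadditive_finite) auto
    also have "\<dots> \<le> (\<Sum>i\<le>n. ennreal (c k * S * (T / real (Suc n))))"
      using bad by (intro sum_mono) auto
    also have "\<dots> = ennreal (real (Suc n) * (c k * S * (T / real (Suc n))))"
      using c(1)[of k] S T
      by (simp add: ennreal_of_nat_eq_real_of_nat flip: ennreal_mult' del: of_nat_Suc)
    also have "real (Suc n) * (c k * S * (T / real (Suc n))) = c k * S * T" by simp
    finally show "emeasure M (F k m n) \<le> ennreal (c k * S * T)" .
  qed
  \<comment> \<open>First \<open>n\<close> tends to infinity for a fixed threshold \<open>e m\<close>, and only then does the threshold tend to \<open>0\<close>: how fine the partition must be depends on the threshold and on \<open>\<omega>\<close>.\<close>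
  define G where "G k m = {\<omega>\<in>space M. \<forall>\<^sub>F n in sequentially. \<omega> \<in> F k m n}" for k m
  have G: "G k m \<in> sets M" "emeasure M (G k m) \<le> ennreal (c k * S * T)" for k m
    unfolding G_def by (rule emeasure_eventually_in_le[OF F])+
  define H where "H k = {\<omega>\<in>space M. \<forall>\<^sub>F m in sequentially. \<omega> \<in> G k m}" for k
  have H: "H k \<in> sets M" "emeasure M (H k) \<le> ennreal (c k * S * T)" for k
    unfolding H_def by (rule emeasure_eventually_in_le[OF G])+
  have "emeasure M (\<Inter>k. H k) \<le> ennreal 0"
  proof (rule Lim_bounded2)
    show "(\<lambda>k. ennreal (c k * S * T)) \<longlonglongrightarrow> ennreal 0"
      using tendsto_mult_right[OF tendsto_mult_right[OF c(2), of S], of T]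
      by (intro tendsto_ennrealI) simp
    have "emeasure M (\<Inter>k. H k) \<le> emeasure M (H k)" for k
      using H(1) by (intro emeasure_mono) auto
    then show "\<forall>n\<ge>0. emeasure M (\<Inter>k. H k) \<le> ennreal (c n * S * T)"
      using H(2) order_trans by blast
  qed
  moreover have "(\<Inter>k. H k) \<in> sets M" using H(1) by (intro sets.countable_INT) auto
  ultimately have null: "(\<Inter>k. H k) \<in> null_sets M" by auto
  have "\<omega> \<in> H k" if w: "\<omega> \<in> space M" and t: "t \<in> {0<..T}" and j: "0 < ?J \<omega> t" "?J \<omega> t \<le> L"
    and notin: "Zm t \<omega> \<notin> B k" for \<omega> k t
  proof -
    have "(\<lambda>m. e m) \<longlonglongrightarrow> 0"
      unfolding e_def using LIMSEQ_Suc[OF lim_const_over_n[of 1]] by simp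
    then have "\<forall>\<^sub>F m in sequentially. e m < ?J \<omega> t"
      using j(1) by (rule order_tendstoD)
    then have "\<forall>\<^sub>F m in sequentially. \<omega> \<in> G k m"
    proof eventually_elim
      case (elim m)
      have "\<forall>\<^sub>F n in sequentially. \<omega> \<in> F k m n"
        using eventually_first_jump_grid[OF cadlag[OF w] e t elim]
      proof eventually_elim
        case (elim n)
        then obtain i where i: "i \<le> n" "t \<in> grid_cell 0 T n i" "\<tau> m n i \<omega> = t"
          by (auto simp: \<tau>_def)
        then have "\<omega> \<in> bad k m n i"
          using w j notin \<open>e m < ?J \<omega> t\<close> by (auto simp: bad_def A_def grid_cell_def)
        then show ?case using i(1) by (auto simp: F_def)
      qed
      then show ?case using w by (simp add: G_def)
    qed
    then show ?thesis using w by (simp add: H_def)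
  qed
  then show ?thesis
    by (intro AE_I'[OF null]) blast
qed

section \<open>Hoelder constants of rescaled bridges\<close>

definition hoelder_paths :: "real \<Rightarrow> real \<Rightarrow> (real \<Rightarrow> real) set" where
  "hoelder_paths \<gamma> K =
     {f. continuous_on UNIV f \<and> (\<forall>r s. \<bar>f s - f r\<bar> \<le> K * \<bar>s - r\<bar> powr \<gamma>)}"

lemma space_path_space: "space path_space = {f. continuous_on UNIV f}"
  by (auto simp: path_space_def space_restrict_space space_PiM)

lemma measurable_eval_path_space [measurable]: "(\<lambda>f. f s) \<in> borel_measurable path_space"
  unfolding path_space_def
  by (intro measurable_restrict_space1 measurable_component_singleton) auto

text \<open>
  By continuity of \<open>f\<close> and of \<open>\<bar>s - r\<bar> powr \<gamma>\<close> (this is where \<open>\<gamma> > 0\<close> enters), it suffices to compare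
  at rational points.
\<close>

lemma sets_hoelder_paths:
  assumes "0 < \<gamma>"
  shows "hoelder_paths \<gamma> K \<in> sets path_space"
proof -
  have "{f\<in>space path_space. \<forall>r\<in>\<rat>. \<forall>s\<in>\<rat>. \<bar>f s - f r\<bar> \<le> K * \<bar>s - r\<bar> powr \<gamma>} \<in> sets path_space"
    using countable_rat by measurable
  also have "{f\<in>space path_space. \<forall>r\<in>\<rat>. \<forall>s\<in>\<rat>. \<bar>f s - f r\<bar> \<le> K * \<bar>s - r\<bar> powr \<gamma>} = hoelder_paths \<gamma> K"
  proof -
    have "\<bar>f s - f r\<bar> \<le> K * \<bar>s - r\<bar> powr \<gamma>"
      if f: "continuous_on UNIV f" and Q: "\<forall>r\<in>\<rat>. \<forall>s\<in>\<rat>. \<bar>f s - f r\<bar> \<le> K * \<bar>s - r\<bar> powr \<gamma>" for f r s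
    proof -
      let ?g = "\<lambda>p::real \<times> real. \<bar>f (snd p) - f (fst p)\<bar>"
      let ?h = "\<lambda>p::real \<times> real. K * \<bar>snd p - fst p\<bar> powr \<gamma>"
      have "closure (\<rat> \<times> \<rat> :: (real \<times> real) set) = UNIV"
        by (simp add: closure_Times Rats_closure_real)
      then have mem: "(r, s) \<in> closure (\<rat> \<times> \<rat>)" by simp
      have "continuous_on UNIV (\<lambda>p::real \<times> real. \<bar>snd p - fst p\<bar> powr \<gamma>)"
        using assms by (intro continuous_on_powr') (auto intro!: continuous_intros)
      moreover have "continuous_on UNIV ?g"
        by (intro continuous_intros continuous_on_compose2[OF f]) auto
      ultimately have "continuous_on (closure (\<rat> \<times> \<rat>)) (\<lambda>p. ?g p - ?h p)"
        by (intro continuous_on_diff continuous_on_mult_left) (auto intro: continuous_on_subset)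
      then have "?g (r, s) - ?h (r, s) \<le> 0"
        using mem Q by (rule_tac continuous_le_on_closure[where S = "\<rat> \<times> \<rat>"]) auto
      then show ?thesis by simp
    qed
    then show ?thesis unfolding hoelder_paths_def space_path_space by blast
  qed
  finally show ?thesis .
qed

lemma hoelder_const_le:
  assumes "f \<in> hoelder_paths \<gamma> K"
  shows "hoelder_const \<gamma> x f \<le> ennreal K"
  unfolding hoelder_const_def
proof (rule SUP_least, clarify)
  fix r s :: real
  assume "r < s"
  moreover have "\<bar>f s - f r\<bar> \<le> K * \<bar>s - r\<bar> powr \<gamma>"
    using assms by (simp add: hoelder_paths_def)
  ultimately show "ennreal (\<bar>f s - f r\<bar> / \<bar>s - r\<bar> powr \<gamma>) \<le> ennreal K"
    by (intro ennreal_leI) (simp add: divide_le_eq)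
qed

lemma hoelder_const_finite:
  assumes "hoelder_on \<gamma> {0..x} f"
  shows "hoelder_const \<gamma> x f < \<infinity>"
proof -
  obtain C where C: "\<And>r s. r \<in> {0..x} \<Longrightarrow> s \<in> {0..x} \<Longrightarrow> \<bar>f s - f r\<bar> \<le> C * \<bar>s - r\<bar> powr \<gamma>"
    using assms unfolding hoelder_on_def by blast
  have "hoelder_const \<gamma> x f \<le> ennreal C"
    unfolding hoelder_const_def
  proof (rule SUP_least, clarify)
    fix r s :: real
    assume "0 \<le> r" "r < s" "s \<le> x"
    then show "ennreal (\<bar>f s - f r\<bar> / \<bar>s - r\<bar> powr \<gamma>) \<le> ennreal C"
      using C[of r s] by (intro ennreal_leI) (simp add: divide_le_eq)
  qed
  also have "\<dots> < \<infinity>" by simp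
  finally show ?thesis .
qed

text \<open>
  Vanishing at the endpoints and outside \<open>[0, 1]\<close>, the path factors through the retraction of the
  line onto \<open>[0, 1]\<close>, which does not increase distances. Working on the whole line makes the set of
  good paths the same for all jump sizes.
\<close>

lemma bridge_hoelder_on_line:
  assumes f: "nonneg_bridge 1 f" and fin: "hoelder_const \<gamma> 1 f < \<infinity>" and \<gamma>: "0 < \<gamma>"
  shows "\<bar>f s - f r\<bar> \<le> enn2real (hoelder_const \<gamma> 1 f) * \<bar>s - r\<bar> powr \<gamma>"
proof -
  let ?D = "enn2real (hoelder_const \<gamma> 1 f)"
  have lt: "\<bar>f s - f r\<bar> \<le> ?D * \<bar>s - r\<bar> powr \<gamma>" if "0 \<le> r" "r < s" "s \<le> 1" for r s
  proof -
    have "ennreal (\<bar>f s - f r\<bar> / \<bar>s - r\<bar> powr \<gamma>) \<le> hoelder_const \<gamma> 1 f"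
      unfolding hoelder_const_def using that by (intro SUP_upper2[of "(r, s)"]) auto
    then have "\<bar>f s - f r\<bar> / \<bar>s - r\<bar> powr \<gamma> \<le> ?D"
      using fin by (metis enn2real_ennreal enn2real_mono divide_nonneg_nonneg abs_ge_zero powr_ge_zero infinity_ennreal_def)
    then show ?thesis using that by (simp add: divide_le_eq)
  qed
  have unit: "\<bar>f s - f r\<bar> \<le> ?D * \<bar>s - r\<bar> powr \<gamma>" if "r \<in> {0..1}" "s \<in> {0..1}" for r s
    using lt[of r s] lt[of s r] that by (cases r s rule: linorder_cases) (auto simp: abs_minus_commute)
  define cl :: "real \<Rightarrow> real" where "cl u = max 0 (min 1 u)" for u
  have f_cl: "f u = f (cl u)" for u
  proof (cases "u \<in> {0..1}")
    case True
    then show ?thesis by (simp add: cl_def)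
  next
    case False
    then have "cl u = 0 \<or> cl u = 1" by (auto simp: cl_def)
    then show ?thesis using f False by (auto simp: nonneg_bridge_def)
  qed
  have "\<bar>f s - f r\<bar> \<le> ?D * \<bar>cl s - cl r\<bar> powr \<gamma>"
    unfolding f_cl[of s] f_cl[of r] by (intro unit) (auto simp: cl_def)
  also have "\<dots> \<le> ?D * \<bar>s - r\<bar> powr \<gamma>"
    using \<gamma> by (intro mult_left_mono powr_mono2) (auto simp: cl_def)
  finally show ?thesis .
qed

lemma rescaled_hoelder_paths:
  assumes f: "continuous_on UNIV f" "\<And>r s. \<bar>f s - f r\<bar> \<le> D * \<bar>s - r\<bar> powr \<gamma>"
    and x: "0 < x" and K: "x powr (q - \<gamma>) * D \<le> K"
  shows "(\<lambda>s. x powr q * f (s / x)) \<in> hoelder_paths \<gamma> K"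
proof -
  have "\<bar>x powr q * f (s / x) - x powr q * f (r / x)\<bar> \<le> K * \<bar>s - r\<bar> powr \<gamma>" for r s
  proof -
    have "\<bar>x powr q * f (s / x) - x powr q * f (r / x)\<bar> = x powr q * \<bar>f (s / x) - f (r / x)\<bar>"
      by (simp add: abs_mult flip: right_diff_distrib)
    also have "\<dots> \<le> x powr q * (D * \<bar>s / x - r / x\<bar> powr \<gamma>)"
      by (intro mult_left_mono f(2)) auto
    also have "\<bar>s / x - r / x\<bar> = \<bar>s - r\<bar> / x"
      using x by (simp flip: diff_divide_distrib)
    also have "x powr q * (D * (\<bar>s - r\<bar> / x) powr \<gamma>) = x powr (q - \<gamma>) * D * \<bar>s - r\<bar> powr \<gamma>"
      using x by (simp add: powr_divide powr_diff)
    also have "\<dots> \<le> K * \<bar>s - r\<bar> powr \<gamma>"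
      using K by (intro mult_right_mono) auto
    finally show ?thesis .
  qed
  moreover have "continuous_on UNIV (\<lambda>s. x powr q * f (s / x))"
    using x by (intro continuous_intros continuous_on_compose2[OF f(1)]) auto
  ultimately show ?thesis by (simp add: hoelder_paths_def)
qed

lemma measurable_rescaled_path:
  assumes Z: "Z \<in> N \<rightarrow>\<^sub>M path_space" and x: "0 < x"
  shows "(\<lambda>\<omega> s. x powr q * Z \<omega> (s / x)) \<in> N \<rightarrow>\<^sub>M path_space"
proof -
  have [measurable]: "(\<lambda>\<omega>. Z \<omega> s) \<in> borel_measurable N" for s
    using measurable_compose[OF Z measurable_eval_path_space] .
  have cont: "continuous_on UNIV (Z \<omega>)" if "\<omega> \<in> space N" for \<omega>
    using measurable_space[OF Z that] by (simp add: space_path_space)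
  show ?thesis
    unfolding path_space_def
  proof (rule measurable_restrict_space2)
    show "(\<lambda>\<omega> s. x powr q * Z \<omega> (s / x)) \<in> space N \<rightarrow> {f. continuous_on UNIV f}"
      using x by (auto intro!: continuous_intros continuous_on_compose2[OF cont])
    show "(\<lambda>\<omega> s. x powr q * Z \<omega> (s / x)) \<in> N \<rightarrow>\<^sub>M Pi\<^sub>M UNIV (\<lambda>_. borel)"
      by (rule measurable_PiM_single') auto
  qed
qed

text \<open>
  The rescaled path has Hoelder constant \<open>x powr (q - \<gamma>) * D\<close>. The exponent \<open>p\<close> satisfies
  \<open>(q - \<gamma>) * p = 2\<close>, so Markov's inequality for \<open>D powr p\<close> produces the factor \<open>x\<^sup>2\<close>.
\<close>

lemma scaled_law_hoelder_paths:
  fixes \<gamma> q K x :: real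
  defines "p \<equiv> 2 / (q - \<gamma>)"
  assumes "prob_space N" and Z: "Z \<in> N \<rightarrow>\<^sub>M path_space"
    and bridge: "\<And>\<omega>. \<omega> \<in> space N \<Longrightarrow> nonneg_bridge 1 (Z \<omega>)"
    and hoelder: "AE \<omega> in N. hoelder_on \<gamma> {0..1} (Z \<omega>)"
    and \<gamma>: "0 < \<gamma>" "\<gamma> < q" and x: "0 < x" and K: "0 < K"
    and int: "integrable N (\<lambda>\<omega>. \<bar>enn2real (hoelder_const \<gamma> 1 (Z \<omega>))\<bar> powr p)"
  shows "1 \<le> emeasure (scaled_law N Z q x) (hoelder_paths \<gamma> K) +
    ennreal ((\<integral>\<omega>. \<bar>enn2real (hoelder_const \<gamma> 1 (Z \<omega>))\<bar> powr p \<partial>N) / K powr p * x\<^sup>2)"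
proof -
  interpret prob_space N by fact
  let ?D = "\<lambda>\<omega>. enn2real (hoelder_const \<gamma> 1 (Z \<omega>))"
  let ?Zx = "\<lambda>\<omega> s. x powr q * Z \<omega> (s / x)"
  let ?G = "?Zx -` hoelder_paths \<gamma> K \<inter> space N"
  let ?bad = "{\<omega>\<in>space N. K powr p / x\<^sup>2 \<le> \<bar>?D \<omega>\<bar> powr p}"
  have p: "0 < p" "(q - \<gamma>) * p = 2" using \<gamma> by (auto simp: p_def field_simps)
  have Zx: "?Zx \<in> N \<rightarrow>\<^sub>M path_space" by (rule measurable_rescaled_path[OF Z x])
  have G: "?G \<in> sets N" using Zx sets_hoelder_paths[OF \<gamma>(1)] by (rule measurable_sets)
  note borel_measurable_integrable[OF int, measurable]
  have bad: "?bad \<in> sets N" by measurable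
  have "AE \<omega> in N. \<omega> \<in> ?G \<union> ?bad"
    using hoelder AE_space
  proof eventually_elim
    case (elim \<omega>)
    have "\<omega> \<in> ?G" if "\<bar>?D \<omega>\<bar> powr p < K powr p / x\<^sup>2"
    proof -
      have "(x powr (q - \<gamma>) * ?D \<omega>) powr p = x\<^sup>2 * ?D \<omega> powr p"
        using x p by (simp add: powr_mult powr_powr)
      also have "\<dots> < K powr p"
        using that x by (simp add: field_simps)
      finally have "x powr (q - \<gamma>) * ?D \<omega> \<le> K"
        using p K powr_mono2[of p K "x powr (q - \<gamma>) * ?D \<omega>"] by linarith
      moreover have "continuous_on UNIV (Z \<omega>)"
        using bridge[OF elim(2)] by (simp add: nonneg_bridge_def)
      ultimately show ?thesis
        using elim bridge_hoelder_on_line[OF bridge hoelder_const_finite \<gamma>(1)] x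
        by (auto intro!: rescaled_hoelder_paths)
    qed
    then show ?case using elim(2) by force
  qed
  then have "prob (?G \<union> ?bad) = 1"
    by (rule iffD2[OF prob_eq_1[OF sets.Un[OF G bad]]])
  then have "1 \<le> emeasure N (?G \<union> ?bad)"
    unfolding emeasure_eq_measure by (simp only: ennreal_1 order_refl)
  also have "\<dots> \<le> emeasure N ?G + emeasure N ?bad"
    using G bad by (rule emeasure_subadditive)
  also have "emeasure N ?G = emeasure (scaled_law N Z q x) (hoelder_paths \<gamma> K)"
    unfolding scaled_law_def by (rule emeasure_distr[symmetric, OF Zx sets_hoelder_paths[OF \<gamma>(1)]])
  also have "emeasure N ?bad \<le> ennreal ((\<integral>\<omega>. \<bar>?D \<omega>\<bar> powr p \<partial>N) / K powr p * x\<^sup>2)"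
  proof -
    have "measure N ?bad \<le> (\<integral>\<omega>. \<bar>?D \<omega>\<bar> powr p \<partial>N) / (K powr p / x\<^sup>2)"
      using x K by (intro integral_Markov_inequality_measure[OF int, where A = "{}"]) auto
    also have "\<dots> = (\<integral>\<omega>. \<bar>?D \<omega>\<bar> powr p \<partial>N) / K powr p * x\<^sup>2" by simp
    finally show ?thesis unfolding emeasure_eq_measure by (rule ennreal_leI)
  qed
  finally show ?thesis by (simp add: add_left_mono)
qed

section \<open>The uniform Hoelder constant\<close>

theorem proposition5:
  fixes \<alpha> q \<gamma> c :: real
    and N :: "'b measure" and Z :: "'b \<Rightarrow> real \<Rightarrow> real" and U :: "'b \<Rightarrow> real"
    and M :: "'a measure" and X :: "real \<Rightarrow> 'a \<Rightarrow> real" and Zm :: "real \<Rightarrow> 'a \<Rightarrow> real \<Rightarrow> real"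
  assumes "0 < \<alpha>" "\<alpha> < 1" "\<alpha> < q"
    and "prob_space N"
    and "Z \<in> N \<rightarrow>\<^sub>M path_space"
    and "\<forall>\<omega>\<in>space N. nonneg_bridge 1 (Z \<omega>)"
    and "0 < \<gamma>" "\<gamma> < q"
    and "AE \<omega> in N. hoelder_on \<gamma> {0..1} (Z \<omega>)"
    and "moments_of_all_orders N (\<lambda>\<omega>. enn2real (hoelder_const \<gamma> 1 (Z \<omega>)))"
    and "U \<in> borel_measurable N"
    and "distr N lborel U = uniform_measure lborel {0..1}"
    and "prob_space.indep_set N {Z -` A \<inter> space N |A. A \<in> sets path_space} {U -` B \<inter> space N |B. B \<in> sets borel}"
    and "c = (1 + \<alpha>) * inverse (Gamma (1 - \<alpha>)) * (\<integral>\<omega>. Z \<omega> (U \<omega>) powr (\<alpha> / q) \<partial>N)"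
    and "c > 0"
    and "levy_process M X"
    and "no_negative_jumps M X"
    and "has_laplace_exponent M X (\<lambda>\<eta>. \<eta> powr (1 + \<alpha>))"
    and "marked_process M X (scaled_law N Z q) Zm"
  shows "\<forall>T>0. AE \<omega> in M. uniform_hoelder_const X Zm \<gamma> T \<omega> < \<infinity>"
proof (intro allI impI)
  fix T :: real assume T: "0 < T"
  note X = \<open>levy_process M X\<close> and \<psi> = \<open>has_laplace_exponent M X (\<lambda>\<eta>. \<eta> powr (1 + \<alpha>))\<close>
  define S where "S = 2 powr (1 + \<alpha>) * exp (2 powr (1 + \<alpha>) * T)"
  have S: "0 \<le> S" by (simp add: S_def)
  have incr: "(\<integral>\<^sup>+\<omega>. ennreal (jump_weight (X (s + h) \<omega> - X s \<omega>)) \<partial>M) \<le> ennreal (S * h)"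
    if "0 \<le> s" "0 \<le> h" "h \<le> T" for s h
    using exp_second_difference_le[of "2 powr (1 + \<alpha>)" h T] that
    by (simp add: nn_integral_increment_weight[OF X \<psi>] S_def ennreal_leI)
  define p where "p = 2 / (q - \<gamma>)"
  have p: "0 < p" using \<open>\<gamma> < q\<close> by (simp add: p_def)
  define m where "m = (\<integral>\<omega>. \<bar>enn2real (hoelder_const \<gamma> 1 (Z \<omega>))\<bar> powr p \<partial>N)"
  have m: "0 \<le> m" by (simp add: m_def)
  have int: "integrable N (\<lambda>\<omega>. \<bar>enn2real (hoelder_const \<gamma> 1 (Z \<omega>))\<bar> powr p)"
    using p assms(10) by (simp add: moments_of_all_orders_def)
  have "AE \<omega> in M. \<exists>k. \<forall>t\<in>{0<..T}. 0 < jump (\<lambda>t. X t \<omega>) t \<longrightarrow> jump (\<lambda>t. X t \<omega>) t \<le> real L \<longrightarrow>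
      Zm t \<omega> \<in> hoelder_paths \<gamma> (real (Suc k))" for L :: nat
  proof (rule AE_marks_of_small_jumps_in_some[OF X assms(19) T S incr])
    let ?c = "\<lambda>k. exp (2 * real L) * (m / real (Suc k) powr p)"
    show "hoelder_paths \<gamma> (real (Suc k)) \<in> sets path_space" for k
      using \<open>0 < \<gamma>\<close> by (rule sets_hoelder_paths)
    show "0 \<le> ?c k" for k using m by simp
    have "(\<lambda>k. exp (2 * real L) * m * real (Suc k) powr (- p)) \<longlonglongrightarrow> exp (2 * real L) * m * 0"
      using p by (intro tendsto_mult tendsto_const tendsto_neg_powr
        filterlim_compose[OF filterlim_real_sequentially] filterlim_Suc) auto
    then show "?c \<longlonglongrightarrow> 0" by (simp add: powr_minus_divide del: of_nat_Suc)
    show "1 \<le> emeasure (scaled_law N Z q x) (hoelder_paths \<gamma> (real (Suc k))) + ennreal (?c k * jump_weight x)"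
      if x: "0 < x" "x \<le> real L" for k x
    proof -
      have "1 \<le> emeasure (scaled_law N Z q x) (hoelder_paths \<gamma> (real (Suc k))) + ennreal (m / real (Suc k) powr p * x\<^sup>2)"
        unfolding m_def p_def
        using assms x int by (intro scaled_law_hoelder_paths) (auto simp: p_def)
      also have "m / real (Suc k) powr p * x\<^sup>2 \<le> m / real (Suc k) powr p * (exp (2 * real L) * jump_weight x)"
        using m x by (intro mult_left_mono square_le_jump_weight) auto
      finally show ?thesis by (simp add: mult_ac add_left_mono ennreal_leI)
    qed
  qed
  then have "AE \<omega> in M. \<forall>L. \<exists>k. \<forall>t\<in>{0<..T}. 0 < jump (\<lambda>t. X t \<omega>) t \<longrightarrow> jump (\<lambda>t. X t \<omega>) t \<le> real L \<longrightarrow>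
      Zm t \<omega> \<in> hoelder_paths \<gamma> (real (Suc k))"
    unfolding AE_all_countable by blast
  then show "AE \<omega> in M. uniform_hoelder_const X Zm \<gamma> T \<omega> < \<infinity>"
    using AE_space
  proof eventually_elim
    case (elim \<omega>)
    let ?J = "jump (\<lambda>t. X t \<omega>)"
    \<comment> \<open>\<open>L\<close> depends on \<open>\<omega>\<close>, which is why the almost sure statement was needed for all \<open>L\<close> at once.\<close>
    have "cadlag (\<lambda>t. X t \<omega>)" using X elim(2) by (simp add: levy_process_def)
    then obtain L :: nat where L: "\<And>u. u \<in> {0<..T} \<Longrightarrow> ?J u \<le> real L"
      using jumps_bounded by blast
    obtain k where k: "\<And>t. t \<in> {0<..T} \<Longrightarrow> 0 < ?J t \<Longrightarrow> ?J t \<le> real L \<Longrightarrow>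
        Zm t \<omega> \<in> hoelder_paths \<gamma> (real (Suc k))"
      using elim(1) by blast
    have "hoelder_const \<gamma> (?J t) (Zm t \<omega>) \<le> ennreal (real (Suc k))" if "t \<in> {0..T}" for t
    proof (cases "0 < ?J t")
      case True
      then have "t \<in> {0<..T}" using that by (auto simp: jump_def split: if_splits)
      then show ?thesis using True k L by (intro hoelder_const_le) auto
    next
      case False
      then show ?thesis unfolding hoelder_const_def by (intro SUP_least) auto
    qed
    then have "uniform_hoelder_const X Zm \<gamma> T \<omega> \<le> ennreal (real (Suc k))"
      unfolding uniform_hoelder_const_def by (rule SUP_least)
    also have "\<dots> < \<infinity>" by simp
    finally show ?case .
  qed
qed

end
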